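(* Let $x_1=(0,1)$, $b_1=2$, $l_1=0$, and for $i\ge2$ let $x_i=C_{i,i^2}$, $b_i=i$, $l_i=i^{3i}$. Let $Q=(q_n)$ and $x$ be the basic sequence and real number associated with $(l_i),(b_i),(x_i)$ as described in the context. Then $x$ is $Q$-distribution normal.
   Context: A block of length $k$ is a $k$-tuple of non-negative integers; $|B|$ denotes its length. For integers $b\ge2$, $w\ge1$, $C_{b,w}$ denotes the block formed by concatenating all blocks of length $w$ with digits in $\{0,\dots,b-1\}$, each once, in lexicographic order (e.g. $C_{3,2}=(0,0,0,1,0,2,1,0,1,1,1,2,2,0,2,1,2,2)$). Associated $Q$ and $x$: put $L_0=0$, $L_i=\sum_{j=1}^i l_j|x_j|$, $q_n=b_i$ for $L_{i-1}<n\le L_i$, $Q=(q_n)_{n\ge1}$; let $(E_1,E_2,\dots)$ be the infinite sequence formed by concatenating $l_1$ copies of $x_1$, then $l_2$ copies of $x_2$, etc.; and $x=\sum_{n\ge1}E_n/(q_1\cdots q_n)$. For a basic sequence $Q$ and $x\in[0,1)$, $T_{Q,n}(x)=q_1\cdots q_n x\pmod 1$ (with $T_{Q,0}(x)=x$). The number $x$ is $Q$-distribution normal if the sequence $(T_{Q,n}(x))_{n=0}^\infty$ is uniformly distributed modulo $1$. *)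

theory Defs
  imports Complex_Main
begin

type_synonym block = "nat list"

definition lex_blocks :: "nat \<Rightarrow> nat \<Rightarrow> block list" where
  "lex_blocks b w = product_lists (replicate w [0..<b])"

definition C_block :: "nat \<Rightarrow> nat \<Rightarrow> block" where
  "C_block b w = concat (lex_blocks b w)"

lemma set_lex_blocks: "set (lex_blocks b w) = {B. length B = w \<and> set B \<subseteq> {..<b}}"
proof (induction w)
  case (Suc w)
  then show ?case
    by (auto simp: lex_blocks_def length_Suc_conv image_iff)
qed (auto simp: lex_blocks_def)

lemma lex_blocks_sorted: "sorted_wrt (\<lambda>u v. (u, v) \<in> lex less_than) (lex_blocks b w)"
proof (induction w)
  case (Suc w)
  have "sorted_wrt (\<lambda>u v. (u, v) \<in> lex less_than)
          (concat (map (\<lambda>d. map ((#) d) (lex_blocks b w)) [0..<n]))" for n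
  proof (induction n)
    case (Suc n)
    then show ?case
      using \<open>sorted_wrt _ (lex_blocks b w)\<close>
      by (auto simp: sorted_wrt_append sorted_wrt_map set_lex_blocks)
  qed simp
  then show ?case by (simp add: lex_blocks_def)
qed (simp add: lex_blocks_def)

lemma "C_block 3 2 = [0,0,0,1,0,2,1,0,1,1,1,2,2,0,2,1,2,2]"
  by (simp add: C_block_def lex_blocks_def numeral_2_eq_2 numeral_3_eq_3)

text \<open>
  The sequences \<open>l\<close>, \<open>b\<close>, \<open>X\<close>, the basic sequence and the digit sequence are indexed from \<open>1\<close>;
  values at \<open>0\<close> are never used.
\<close>

definition partial_len :: "(nat \<Rightarrow> nat) \<Rightarrow> (nat \<Rightarrow> block) \<Rightarrow> nat \<Rightarrow> nat" where
  "partial_len l X i = (\<Sum>j=1..i. l j * length (X j))"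

definition stage :: "(nat \<Rightarrow> nat) \<Rightarrow> (nat \<Rightarrow> block) \<Rightarrow> nat \<Rightarrow> nat" where
  "stage l X n = (THE i. 1 \<le> i \<and> partial_len l X (i - 1) < n \<and> n \<le> partial_len l X i)"

definition assoc_Q :: "(nat \<Rightarrow> nat) \<Rightarrow> (nat \<Rightarrow> nat) \<Rightarrow> (nat \<Rightarrow> block) \<Rightarrow> nat \<Rightarrow> nat" where
  "assoc_Q l b X n = b (stage l X n)"

definition concat_upto :: "(nat \<Rightarrow> nat) \<Rightarrow> (nat \<Rightarrow> block) \<Rightarrow> nat \<Rightarrow> block" where
  "concat_upto l X i = concat (map (\<lambda>j. concat (replicate (l j) (X j))) [1..<Suc i])"

text \<open>
  The infinite concatenation is the common extension of the finite blocks \<open>concat_upto l X i\<close>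
  (see \<open>assoc_E_eq\<close> below); its \<open>n\<close>-th digit is read off from the first one that is long enough.
\<close>

definition assoc_E :: "(nat \<Rightarrow> nat) \<Rightarrow> (nat \<Rightarrow> block) \<Rightarrow> nat \<Rightarrow> nat" where
  "assoc_E l X n = concat_upto l X (stage l X n) ! (n - 1)"

definition assoc_x :: "(nat \<Rightarrow> nat) \<Rightarrow> (nat \<Rightarrow> nat) \<Rightarrow> (nat \<Rightarrow> block) \<Rightarrow> real" where
  "assoc_x l b X =
     (\<Sum>n. real (assoc_E l X (Suc n)) / real (\<Prod>j=1..Suc n. assoc_Q l b X j))"

lemma partial_len_mono: "i \<le> j \<Longrightarrow> partial_len l X i \<le> partial_len l X j"
  unfolding partial_len_def by (rule sum_mono2) auto

lemma stage_eqI: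
  assumes "1 \<le> i" "partial_len l X (i - 1) < n" "n \<le> partial_len l X i"
  shows "stage l X n = i"
  unfolding stage_def
proof (rule the_equality)
  fix k assume k: "1 \<le> k \<and> partial_len l X (k - 1) < n \<and> n \<le> partial_len l X k"
  show "k = i"
  proof (rule linorder_cases[of k i])
    assume "k < i"
    then have "partial_len l X k \<le> partial_len l X (i - 1)" by (intro partial_len_mono) auto
    with k assms show ?thesis by linarith
  next
    assume "i < k"
    then have "partial_len l X i \<le> partial_len l X (k - 1)" by (intro partial_len_mono) auto
    with k assms show ?thesis by linarith
  qed
qed (use assms in auto)

lemma stage_exists:
  assumes "1 \<le> n" "n \<le> partial_len l X m"
  obtains i where "1 \<le> i" "i \<le> m" "partial_len l X (i - 1) < n" "n \<le> partial_len l X i"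
proof -
  define i where "i = (LEAST i. n \<le> partial_len l X i)"
  have 1: "n \<le> partial_len l X i" "i \<le> m"
    unfolding i_def using assms(2) by (auto intro: LeastI Least_le)
  have "i \<noteq> 0" using 1 assms(1) by (intro notI) (simp add: partial_len_def)
  moreover from this have "\<not> n \<le> partial_len l X (i - 1)"
    unfolding i_def by (intro not_less_Least) auto
  ultimately show ?thesis using that[of i] 1 by auto
qed

lemma length_concat_upto: "length (concat_upto l X i) = partial_len l X i"
  by (induction i)
    (simp_all add: concat_upto_def partial_len_def length_concat map_replicate_const sum_list_replicate)

lemma concat_upto_prefix: "i \<le> j \<Longrightarrow> \<exists>ys. concat_upto l X j = concat_upto l X i @ ys"
proof (induction rule: dec_induct)
  case (step n)
  have "concat_upto l X (Suc n) = concat_upto l X n @ concat (replicate (l (Suc n)) (X (Suc n)))"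
    by (simp add: concat_upto_def)
  with step.IH show ?case by auto
qed simp

lemma assoc_E_eq:
  assumes "1 \<le> n" "n \<le> partial_len l X m"
  shows "assoc_E l X n = concat_upto l X m ! (n - 1)"
proof -
  obtain i where i: "1 \<le> i" "i \<le> m" "partial_len l X (i - 1) < n" "n \<le> partial_len l X i"
    using assms by (rule stage_exists)
  obtain ys where "concat_upto l X m = concat_upto l X i @ ys"
    using concat_upto_prefix i(2) by blast
  moreover have "n - 1 < partial_len l X i" using i(4) assms(1) by linarith
  ultimately show ?thesis
    by (simp add: assoc_E_def stage_eqI[OF i(1,3,4)] nth_append length_concat_upto)
qed

definition T_map :: "(nat \<Rightarrow> nat) \<Rightarrow> nat \<Rightarrow> real \<Rightarrow> real" where
  "T_map Q n x = frac (real (\<Prod>j=1..n. Q j) * x)"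

lemma T_map_0: "x \<in> {0..<1} \<Longrightarrow> T_map Q 0 x = x"
  by (simp add: T_map_def frac_eq)

definition uniformly_distributed_mod1 :: "(nat \<Rightarrow> real) \<Rightarrow> bool" where
  "uniformly_distributed_mod1 s \<longleftrightarrow>
     (\<forall>\<alpha> \<beta>. 0 \<le> \<alpha> \<and> \<alpha> < \<beta> \<and> \<beta> \<le> 1 \<longrightarrow>
        (\<lambda>N. real (card {n. n < N \<and> frac (s n) \<in> {\<alpha>..<\<beta>}}) / real N) \<longlonglongrightarrow> \<beta> - \<alpha>)"

definition distribution_normal :: "(nat \<Rightarrow> nat) \<Rightarrow> real \<Rightarrow> bool" where
  "distribution_normal Q x \<longleftrightarrow> uniformly_distributed_mod1 (\<lambda>n. T_map Q n x)"

end

theory Submission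
  imports Defs "HOL-Real_Asymp.Real_Asymp"
begin

text \<open>
  While the base is \<open>i\<close>, the point \<open>T\<^sub>n(x)\<close> lies in the cell \<open>[d / i, (d + 1) / i]\<close> of the next
  digit \<open>d = E\<^sub>n\<^sub>+\<^sub>1\<close>, so only the frequencies of single digits matter. Every digit occurs equally
  often in \<open>C\<^sub>i\<^sub>,\<^sub>w\<close>; hence over one copy of it the number of visits to \<open>[0, t)\<close> deviates from its
  expected value by at most \<open>3 / i\<close> times the length of the copy. Since a copy of \<open>x\<^sub>i\<^sub>+\<^sub>1\<close> is
  negligible compared with \<open>L\<^sub>i\<close>, an incomplete last copy does not affect the averages.
\<close>

section \<open>Averages along a concatenation of repeated blocks\<close>

lemma sum_lessThan_add:
  fixes a :: "nat \<Rightarrow> 'a::comm_monoid_add"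
  shows "(\<Sum>n<M + K. a n) = (\<Sum>n<M. a n) + (\<Sum>r<K. a (M + r))"
  by (induction K) (simp_all add: add.assoc)

text \<open>Positions \<open>n\<close> count from 0, so the stage sought is that of digit
  \<open>Suc n\<close>. Dividing the offset of \<open>n\<close> within that stage by the block
  length gives the copy \<open>m\<close> and the place \<open>r\<close> in it.\<close>

lemma copy_exists:
  assumes "n < partial_len l X j"
  obtains i m r where "1 \<le> i" "m < l i" "r < length (X i)"
    "n = partial_len l X (i - 1) + m * length (X i) + r"
proof -
  obtain i where i: "1 \<le> i" "partial_len l X (i - 1) < Suc n" "Suc n \<le> partial_len l X i"
    using stage_exists[of "Suc n" l X j] assms by auto
  let ?K = "length (X i)" and ?s = "n - partial_len l X (i - 1)"
  have "partial_len l X i = partial_len l X (i - 1) + l i * ?K"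
    using i(1) by (cases i) (simp_all add: partial_len_def)
  then have s: "?s < l i * ?K" using i by linarith
  then have "?K > 0" by (intro gr0I) simp
  moreover have "?s div ?K < l i" using s by (rule less_mult_imp_div_less)
  moreover have "n = partial_len l X (i - 1) + ?s div ?K * ?K + ?s mod ?K" using i by simp
  ultimately show ?thesis using that[of i "?s div ?K" "?s mod ?K"] i(1) by simp
qed

text \<open>From some stage \<open>k\<close> on, every complete copy changes the sum by at most
  \<delta> times its length. What precedes \<open>L k\<close> contributes a bounded amount, and an
  incomplete last copy is short compared with \<open>L i\<close>.\<close>

lemma averages_tendsto_zero_if_blockwise:
  fixes a e :: "nat \<Rightarrow> real" and l :: "nat \<Rightarrow> nat" and X :: "nat \<Rightarrow> block"
  defines "L \<equiv> partial_len l X"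
  assumes bounded: "\<And>n. \<bar>a n\<bar> \<le> 1"
    and block: "\<And>i m. \<lbrakk>1 \<le> i; m < l i\<rbrakk> \<Longrightarrow>
      \<bar>\<Sum>r<length (X i). a (L (i - 1) + m * length (X i) + r)\<bar> \<le> e i * length (X i)"
    and e: "e \<longlonglongrightarrow> 0"
    and ratio: "(\<lambda>i. length (X (Suc i)) / L i) \<longlonglongrightarrow> 0"
    and L: "filterlim L at_top sequentially"
  shows "(\<lambda>N. (\<Sum>n<N. a n) / N) \<longlonglongrightarrow> 0"
proof (rule LIMSEQ_I)
  fix \<epsilon> :: real assume "\<epsilon> > 0"
  \<comment> \<open>Three errors of at most \<open>\<delta> * N\<close> will arise: the initial
    part, the complete copies and the incomplete copy. The fourth quarter makes the final inequality
    strict.\<close>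
  define \<delta> where "\<delta> = \<epsilon> / 4"
  have "\<delta> > 0" using \<open>\<epsilon> > 0\<close> by (simp add: \<delta>_def)
  define S where "S N = (\<Sum>n<N. a n)" for N
  have L_Suc: "L (Suc i) = L i + l (Suc i) * length (X (Suc i))" for i
    by (simp add: L_def partial_len_def)
  have "\<forall>\<^sub>F i in sequentially. e i < \<delta>"
    using order_tendstoD(2)[OF e \<open>\<delta> > 0\<close>] .
  moreover have "\<forall>\<^sub>F i in sequentially. length (X (Suc i)) / L i < \<delta>"
    using order_tendstoD(2)[OF ratio \<open>\<delta> > 0\<close>] .
  \<comment> \<open>Excludes \<open>L i = 0\<close>, for which the preceding bound would hold
    trivially, division by zero being 0.\<close>
  moreover have "\<forall>\<^sub>F i in sequentially. L i \<ge> 1"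
    using L by (simp add: filterlim_at_top)
  ultimately have "\<forall>\<^sub>F i in sequentially. e i < \<delta> \<and> length (X (Suc i)) / L i < \<delta> \<and> L i \<ge> 1"
    by eventually_elim auto
  then obtain k where k: "\<And>i. i \<ge> k \<Longrightarrow> e i < \<delta>"
      "\<And>i. i \<ge> k \<Longrightarrow> length (X (Suc i)) / L i < \<delta>" "\<And>i. i \<ge> k \<Longrightarrow> L i \<ge> 1"
    unfolding eventually_sequentially by blast
  have S_le: "\<bar>S N\<bar> \<le> N" for N
  proof -
    have "\<bar>S N\<bar> \<le> (\<Sum>n<N. \<bar>a n\<bar>)" unfolding S_def by (rule sum_abs)
    also have "\<dots> \<le> (\<Sum>n<N. 1)" by (intro sum_mono bounded)
    finally show ?thesis by simp
  qed
  have S_add: "S (M + K) = S M + (\<Sum>r<K. a (M + r))" for M K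
    unfolding S_def by (rule sum_lessThan_add)
  \<comment> \<open>The bound at \<open>L i\<close> is kept as a premise: with
    \<open>m = l (Suc i)\<close> this is the induction step of \<open>stages\<close>, and with
    smaller \<open>m\<close> it later covers an unfinished stage.\<close>
  have copies: "\<bar>S (L i + m * length (X (Suc i)))\<bar>
      \<le> L k + \<delta> * (L i + m * length (X (Suc i)))"
    if "i \<ge> k" "\<bar>S (L i)\<bar> \<le> L k + \<delta> * L i" "m \<le> l (Suc i)" for i m
    using that(3)
  proof (induction m)
    case 0
    then show ?case using that(2) by simp
  next
    case (Suc m)
    let ?K = "length (X (Suc i))"
    let ?M = "L i + m * ?K"
    have "\<bar>\<Sum>r<?K. a (?M + r)\<bar> \<le> e (Suc i) * ?K"
      using block[of "Suc i" m] Suc.prems by simp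
    also have "\<dots> \<le> \<delta> * ?K"
      using k(1)[of "Suc i"] \<open>i \<ge> k\<close> by (intro mult_right_mono) auto
    finally have "\<bar>S (?M + ?K)\<bar> \<le> \<bar>S ?M\<bar> + \<delta> * ?K"
      unfolding S_add by linarith
    moreover have "L i + Suc m * ?K = ?M + ?K" by simp
    ultimately show ?case using Suc.IH Suc.prems
      by (simp add: algebra_simps)
  qed
  have stages: "\<bar>S (L i)\<bar> \<le> L k + \<delta> * L i" if "i \<ge> k" for i
    using that
  proof (induction rule: dec_induct)
    case base
    show ?case using S_le[of "L k"] \<open>\<delta> > 0\<close> by (simp add: add_increasing2)
  next
    case (step i)
    then show ?case using copies[of i "l (Suc i)"] by (simp add: L_Suc)
  qed
  have "\<forall>\<^sub>F N in sequentially. L k / real N < \<delta>"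
    by (rule order_tendstoD(2)[OF _ \<open>\<delta> > 0\<close>]) real_asymp
  then obtain N0 where N0: "\<And>N. N \<ge> N0 \<Longrightarrow> L k / real N < \<delta>"
    unfolding eventually_sequentially by blast
  show "\<exists>N1. \<forall>N\<ge>N1. norm (S N / N - 0) < \<epsilon>"
  proof (intro exI[of _ "max N0 (L k)"] allI impI)
    fix N assume N: "N \<ge> max N0 (L k)"
    obtain j where "L j \<ge> N + 1"
      using L unfolding filterlim_at_top eventually_sequentially by blast
    then have "N < partial_len l X j" by (simp add: L_def)
    then obtain i' m r where i': "1 \<le> i'" "m < l i'" "r < length (X i')"
        "N = L (i' - 1) + m * length (X i') + r"
      unfolding L_def by (rule copy_exists)
    then obtain i where [simp]: "i' = Suc i" by (cases i') auto
    let ?K = "length (X (Suc i))"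
    have N_eq: "N = L i + m * ?K + r" and "m < l (Suc i)" and "r < ?K" using i' by auto
    have "N < L i + Suc m * ?K" using N_eq \<open>r < ?K\<close> by simp
    also have "\<dots> \<le> L (Suc i)"
      unfolding L_Suc using \<open>m < l (Suc i)\<close> by (intro add_left_mono mult_right_mono) auto
    finally have Li: "L i \<le> N" "N < L (Suc i)" using N_eq by auto
    have "i \<ge> k"
    proof (rule ccontr)
      assume "\<not> i \<ge> k"
      then have "L (Suc i) \<le> L k" unfolding L_def by (intro partial_len_mono) auto
      with Li N show False by simp
    qed
    have "N \<ge> 1" using N k(3)[of k] by simp
    have "\<bar>S N\<bar> \<le> \<bar>S (L i + m * ?K)\<bar> + \<bar>\<Sum>s<r. a (L i + m * ?K + s)\<bar>"
      unfolding N_eq S_add by (rule abs_triangle_ineq)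
    also have "\<bar>\<Sum>s<r. a (L i + m * ?K + s)\<bar> \<le> (\<Sum>s<r. 1)"
      by (rule order_trans[OF sum_abs]) (intro sum_mono bounded)
    also have "\<dots> \<le> real ?K" using \<open>r < ?K\<close> by simp
    also have "\<dots> \<le> \<delta> * L i"
      using k(2,3)[OF \<open>i \<ge> k\<close>] by (simp add: field_simps)
    also have "\<bar>S (L i + m * ?K)\<bar> \<le> L k + \<delta> * (L i + m * ?K)"
      using copies[OF \<open>i \<ge> k\<close> stages[OF \<open>i \<ge> k\<close>]] \<open>m < l (Suc i)\<close> by simp
    also have "real (L k) \<le> \<delta> * N"
      using N0[of N] N \<open>N \<ge> 1\<close> by (simp add: field_simps)
    also have "\<delta> * real (L i + m * ?K) \<le> \<delta> * N"
      using N_eq \<open>\<delta> > 0\<close> by (intro mult_left_mono) auto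
    also have "\<delta> * real (L i) \<le> \<delta> * N"
      using Li \<open>\<delta> > 0\<close> by (intro mult_left_mono) auto
    finally have "\<bar>S N\<bar> \<le> 3 * \<delta> * N" by (simp add: algebra_simps)
    also have "\<dots> < \<epsilon> * N" using \<open>N \<ge> 1\<close> \<open>\<epsilon> > 0\<close> by (simp add: \<delta>_def)
    finally show "norm (S N / N - 0) < \<epsilon>"
      using \<open>N \<ge> 1\<close> by (simp add: field_simps)
  qed
qed

section \<open>Digit frequencies in \<open>C_block\<close>\<close>

lemma sum_list_map_concat: "sum_list (map f (concat xss)) = sum_list (map (\<lambda>xs. sum_list (map f xs)) xss)"
  for f :: "'a \<Rightarrow> 'b::monoid_add"
  by (induction xss) auto

lemma lex_blocks_0: "lex_blocks b 0 = [[]]"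
  by (simp add: lex_blocks_def)

lemma lex_blocks_Suc:
  "lex_blocks b (Suc w) = concat (map (\<lambda>d. map ((#) d) (lex_blocks b w)) [0..<b])"
  by (simp add: lex_blocks_def)

lemma length_lex_blocks: "length (lex_blocks b w) = b ^ w"
  by (induction w)
    (simp_all add: lex_blocks_0 lex_blocks_Suc length_concat o_def sum_list_triv)

lemma length_C_block: "length (C_block b w) = w * b ^ w"
proof -
  have "map length (lex_blocks b w) = replicate (b ^ w) w"
    using set_lex_blocks[of b w]
    by (intro replicate_eqI) (auto simp: length_lex_blocks)
  then show ?thesis
    by (simp add: C_block_def length_concat sum_list_replicate)
qed

text \<open>Prefixing \<open>d\<close> to all blocks of length \<open>w\<close> adds
  \<open>b ^ w\<close> occurrences of \<open>d\<close> to one copy of the old digits. So all digits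
  stay equally frequent; the factor \<open>b\<close> on the left avoids the exponent
  \<open>w - 1\<close>.\<close>

lemma sum_list_C_block:
  fixes f :: "nat \<Rightarrow> real"
  shows "b * sum_list (map f (C_block b w)) = w * b ^ w * (\<Sum>d<b. f d)"
proof (induction w)
  case 0
  then show ?case by (simp add: C_block_def lex_blocks_0)
next
  case (Suc w)
  let ?S = "sum_list (map f (C_block b w))"
  have "sum_list (map f (C_block b (Suc w))) = (\<Sum>d\<leftarrow>[0..<b]. b ^ w * f d + ?S)"
    by (simp add: C_block_def lex_blocks_Suc sum_list_map_concat o_def sum_list_addf
        sum_list_triv length_lex_blocks)
  also have "\<dots> = b ^ w * (\<Sum>d<b. f d) + b * ?S"
    by (simp add: sum_list_addf sum_list_triv sum_list_const_mult interv_sum_list_conv_sum_set_nat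
        lessThan_atLeast0)
  finally show ?case
    using Suc.IH by (simp add: algebra_simps)
qed

section \<open>Location of the orbit points\<close>

text \<open>The rescaled tail of the series after \<open>n\<close> digits lies in the closed cell of
  its first digit. It is its own fractional part unless it equals 1, which forces that digit to be
  maximal; \<open>d\<close> rules this out even if all later digits are maximal.\<close>

lemma T_map_bounds:
  fixes q E :: "nat \<Rightarrow> nat"
  assumes E: "\<And>n. n \<ge> 1 \<Longrightarrow> E n < q n"
  defines "x \<equiv> \<Sum>n. real (E (Suc n)) / real (\<Prod>j=1..Suc n. q j)"
  assumes d: "Suc (E (Suc n)) < q (Suc n)"
  shows "E (Suc n) / q (Suc n) \<le> T_map q n x" "T_map q n x \<le> Suc (E (Suc n)) / q (Suc n)"
proof -
  define P where "P n = (\<Prod>j=1..n. q j)" for n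
  \<comment> \<open>\<open>A n\<close> is the numerator of the partial sum over the common
    denominator \<open>P n\<close>. Being an integer, it can be subtracted without changing the
    fractional part.\<close>
  define A where "A = rec_nat 0 (\<lambda>n A. q (Suc n) * A + E (Suc n))"
  have A_simps: "A 0 = 0" "A (Suc n) = q (Suc n) * A n + E (Suc n)" for n
    by (simp_all add: A_def)
  have P_0: "P 0 = 1" by (simp add: P_def)
  have P_Suc: "P (Suc n) = q (Suc n) * P n" for n by (simp add: P_def)
  have q_pos: "q (Suc n) > 0" for n using E[of "Suc n"] by simp
  have P_pos: "P n > 0" for n unfolding P_def using E by (intro prod_pos) fastforce
  have partial: "(\<Sum>m<n. real (E (Suc m)) / P (Suc m)) = A n / P n" for n
  proof (induction n)
    case (Suc n)
    then show ?case using P_pos[of n] q_pos[of n]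
      by (simp add: A_simps P_Suc field_simps)
  qed (simp add: A_simps)
  \<comment> \<open>As \<open>E (Suc n) + 1\<close> is at most \<open>q (Suc n)\<close>, these right
    endpoints never increase. This yields both convergence and the upper bound on
    \<open>x\<close>.\<close>
  have upper_step: "(A (Suc n) + 1) / P (Suc n) \<le> (A n + 1) / P n" for n
  proof -
    have "real (A (Suc n) + 1) \<le> q (Suc n) * (A n + 1)"
      using E[of "Suc n"] by (subst of_nat_le_iff) (simp add: A_simps)
    then have "(A (Suc n) + 1) / P (Suc n) \<le> (q (Suc n) * (A n + 1)) / P (Suc n)"
      by (intro divide_right_mono) auto
    also have "\<dots> = (A n + 1) / P n" using q_pos[of n] by (simp add: P_Suc del: of_nat_add mult_Suc_right add_Suc_right One_nat_def)
    finally show ?thesis .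
  qed
  then have upper: "decseq (\<lambda>n. (A n + 1) / P n)" by (rule decseq_SucI)
  have "summable (\<lambda>m. real (E (Suc m)) / P (Suc m))"
  proof (rule summableI_nonneg_bounded)
    fix n
    have "A n / P n \<le> (A n + 1) / P n" by (simp add: divide_right_mono)
    also have "\<dots> \<le> (A 0 + 1) / P 0" using upper by (rule decseqD) simp
    finally show "(\<Sum>m<n. real (E (Suc m)) / P (Suc m)) \<le> 1"
      unfolding partial by (simp add: A_simps P_0)
  qed simp
  then have sums: "(\<lambda>m. real (E (Suc m)) / P (Suc m)) sums x"
    unfolding x_def P_def by (rule summable_sums)
  then have lim: "(\<lambda>n. A n / P n) \<longlonglongrightarrow> x"
    unfolding sums_def partial .
  have lo: "A n / P n \<le> x" for n
    unfolding partial[symmetric] using sums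
    by (auto simp: sums_iff intro!: sum_le_suminf)
  have hi: "x \<le> (A n + 1) / P n" for n
  proof (rule LIMSEQ_le_const2[OF lim], intro exI allI impI)
    fix m assume "m \<ge> n"
    have "A m / P m \<le> (A m + 1) / P m" by (simp add: divide_right_mono)
    also have "\<dots> \<le> (A n + 1) / P n" using upper \<open>m \<ge> n\<close> by (rule decseqD)
    finally show "A m / P m \<le> (A n + 1) / P n" .
  qed
  define y where "y = P n * x - A n"
  \<comment> \<open>The enclosure of \<open>x\<close> at level \<open>Suc n\<close>, rescaled, puts
    \<open>y\<close> in the cell of the next digit.\<close>
  have "0 \<le> P (Suc n) * x - A (Suc n)" "P (Suc n) * x - A (Suc n) \<le> 1"
    using lo[of "Suc n"] hi[of "Suc n"] P_pos[of "Suc n"] by (simp_all add: field_simps)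
  moreover have "P (Suc n) * x - A (Suc n) = q (Suc n) * y - E (Suc n)"
    by (simp add: y_def P_Suc A_simps algebra_simps)
  ultimately have y: "E (Suc n) / q (Suc n) \<le> y" "y \<le> Suc (E (Suc n)) / q (Suc n)"
    using q_pos[of n] by (simp_all add: field_simps)
  have "real (Suc (E (Suc n))) / q (Suc n) < 1" using d by simp
  moreover have "0 \<le> real (E (Suc n)) / q (Suc n)" by simp
  ultimately have "0 \<le> y" "y < 1" using y by linarith+
  then have "frac (P n * x) = y" by (simp add: frac_unique_iff y_def)
  then have "T_map q n x = y" by (simp add: T_map_def P_def)
  with y show "E (Suc n) / q (Suc n) \<le> T_map q n x" "T_map q n x \<le> Suc (E (Suc n)) / q (Suc n)"
    by simp_all
qed

section \<open>Discrepancy over one copy of \<open>C_block\<close>\<close>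

text \<open>The count is the ceiling of \<open>t\<close>, since \<open>t \<le> b\<close> makes the
  restriction \<open>d < b\<close> automatic.\<close>

lemma sum_of_bool_less_bounds:
  fixes t :: real
  assumes "0 \<le> t" "t \<le> b"
  shows "\<bar>(\<Sum>d<b. of_bool (real d < t)) - t\<bar> \<le> 1"
proof -
  have "{d. d < b \<and> real d < t} = {..<nat \<lceil>t\<rceil>}"
    using assms by (auto simp: less_ceiling_iff zless_nat_eq_int_zless)
  moreover have "(\<Sum>d<b. of_bool (real d < t)) = real (card {d. d < b \<and> real d < t})"
    by (simp add: Int_def)
  ultimately have "(\<Sum>d<b. of_bool (real d < t)) = real (nat \<lceil>t\<rceil>)" by simp
  then show ?thesis using assms by linarith
qed

lemma sum_of_bool_le_one:
  assumes "\<And>x y. \<lbrakk>P x; P y\<rbrakk> \<Longrightarrow> x = y" "finite A"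
  shows "(\<Sum>x\<in>A. of_bool (P x)) \<le> (1::real)"
proof -
  have "card (A \<inter> Collect P) \<le> Suc 0"
    using assms by (intro iffD2[OF card_le_Suc0_iff_eq]) auto
  then show ?thesis using assms(2) by simp
qed

text \<open>Replacing each \<open>u r\<close> by the left end of its cell gives a sum over digits.
  Per \<open>b\<close> digits the error is at most 3: one from counting the digits below
  \<open>t * b\<close>, and one from each of two exceptional digits.\<close>

lemma C_block_discrepancy:
  fixes u :: "nat \<Rightarrow> real" and t :: real and b w :: nat
  defines "C \<equiv> C_block b w"
  assumes b: "b > 0" and t: "0 \<le> t" "t \<le> 1"
    and u: "\<And>r. \<lbrakk>r < length C; Suc (C ! r) < b\<rbrakk> \<Longrightarrow> real (C ! r) / b \<le> u r \<and> u r \<le> Suc (C ! r) / b"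
  shows "\<bar>\<Sum>r<length C. of_bool (u r < t) - t\<bar> \<le> 3 / b * length C"
proof -
  define g :: "nat \<Rightarrow> real" where "g d = of_bool (real d < t * b) - t" for d
  \<comment> \<open>The exceptional digits: the one whose cell contains the endpoint \<open>t\<close>, and \<open>b - 1\<close>, for
    which the value may wrap around from \<open>1\<close> to \<open>0\<close>.\<close>
  define h :: "nat \<Rightarrow> real" where
    "h d = of_bool (Suc d = b) + of_bool (real d < t * b \<and> t * b \<le> real d + 1)" for d
  have C_less: "C ! r < b" if "r < length C" for r
    using nth_mem[OF that] set_lex_blocks[of b w] by (auto simp: C_def C_block_def)
  have average: "b * (\<Sum>r<length C. f (C ! r)) = length C * (\<Sum>d<b. f d)" for f :: "nat \<Rightarrow> real"
    using sum_list_C_block[of b f w]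
    by (simp add: sum_list_sum_nth C_def length_C_block lessThan_atLeast0)
  have "\<bar>of_bool (u r < t) - t - g (C ! r)\<bar> \<le> h (C ! r)" if r: "r < length C" for r
  proof (cases "Suc (C ! r) = b")
    case False
    then have "Suc (C ! r) < b" using C_less[OF r] by simp
    then have "real (C ! r) \<le> u r * b" "u r * b \<le> real (C ! r) + 1"
      using u[OF r] b by (simp_all add: field_simps)
    moreover have "u r < t \<longleftrightarrow> u r * b < t * b" using b by simp
    \<comment> \<open>The indicators can differ only if the digit is below \<open>t * b\<close>
      while \<open>u r\<close> is not below \<open>t\<close>. The cell then contains
      \<open>t\<close>, and \<open>h\<close> pays for it.\<close>
    ultimately have "u r < t \<Longrightarrow> real (C ! r) < t * b"
        "\<lbrakk>\<not> u r < t; real (C ! r) < t * b\<rbrakk> \<Longrightarrow> t * b \<le> real (C ! r) + 1"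
      by linarith+
    then show ?thesis
      unfolding g_def h_def by (cases "u r < t"; cases "real (C ! r) < t * b") simp_all
  qed (auto simp: g_def h_def)
  then have "\<bar>\<Sum>r<length C. of_bool (u r < t) - t - g (C ! r)\<bar> \<le> (\<Sum>r<length C. h (C ! r))"
    by (intro order_trans[OF sum_abs] sum_mono) auto
  then have "\<bar>\<Sum>r<length C. of_bool (u r < t) - t\<bar>
      \<le> \<bar>\<Sum>r<length C. g (C ! r)\<bar> + (\<Sum>r<length C. h (C ! r))"
    by (simp only: sum_subtractf)
  then have "b * \<bar>\<Sum>r<length C. of_bool (u r < t) - t\<bar>
      \<le> b * (\<bar>\<Sum>r<length C. g (C ! r)\<bar> + (\<Sum>r<length C. h (C ! r)))"
    by (intro mult_left_mono) auto
  also have "\<dots> = \<bar>b * (\<Sum>r<length C. g (C ! r))\<bar> + b * (\<Sum>r<length C. h (C ! r))"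
    by (simp add: abs_mult distrib_left)
  also have "\<dots> = length C * (\<bar>\<Sum>d<b. g d\<bar> + (\<Sum>d<b. h d))"
    by (simp add: average abs_mult distrib_left)
  also have "\<dots> \<le> real (length C) * (1 + (1 + 1))"
  proof (intro mult_left_mono add_mono)
    show "\<bar>\<Sum>d<b. g d\<bar> \<le> 1"
      using sum_of_bool_less_bounds[of "t * b" b] t
      by (simp add: g_def sum_subtractf mult.commute[of _ t] mult_left_le_one_le)
    \<comment> \<open>The cell condition in \<open>h\<close> is half-open, so it too singles out at
      most one digit.\<close>
    show "(\<Sum>d<b. h d) \<le> 1 + 1"
      unfolding h_def sum.distrib by (intro add_mono sum_of_bool_le_one) auto
  qed simp
  finally show ?thesis using b by (simp add: field_simps)
qed

section \<open>Digits and bases inside a copy, and growth of the copies\<close>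

lemma nth_concat_replicate:
  "\<lbrakk>m < k; r < length xs\<rbrakk> \<Longrightarrow> concat (replicate k xs) ! (m * length xs + r) = xs ! r"
proof (induction k arbitrary: m)
  case (Suc k)
  then show ?case by (cases m) (auto simp: nth_append add.assoc)
qed simp

text \<open>Here \<open>n\<close> is the index of an orbit point, counted from 0; the digit and base
  that locate this point have index \<open>Suc n\<close>.\<close>

lemma assoc_in_copy:
  assumes "1 \<le> i" "m < l i" "r < length (X i)"
  defines "n \<equiv> partial_len l X (i - 1) + m * length (X i) + r"
  shows "assoc_E l X (Suc n) = X i ! r" "assoc_Q l b X (Suc n) = b i"
proof -
  obtain j where [simp]: "i = Suc j" using assms(1) by (cases i) auto
  have "m * length (X i) + r < Suc m * length (X i)" using assms(3) by simp
  also have "\<dots> \<le> l i * length (X i)" using assms(2) by (intro mult_right_mono) auto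
  finally have n: "Suc n \<le> partial_len l X i"
    by (simp add: n_def partial_len_def)
  have "concat_upto l X i = concat_upto l X j @ concat (replicate (l i) (X i))"
    by (simp add: concat_upto_def)
  moreover have "assoc_E l X (Suc n) = concat_upto l X i ! n"
    using assoc_E_eq[OF _ n] by simp
  ultimately show "assoc_E l X (Suc n) = X i ! r"
    using assms(2,3) nth_concat_replicate[of m "l i" r "X i"]
    by (simp add: nth_append length_concat_upto n_def add.assoc)
  show "assoc_Q l b X (Suc n) = b i"
    unfolding assoc_Q_def by (subst stage_eqI[OF assms(1) _ n]) (simp_all add: n_def)
qed

text \<open>The numerator exceeds \<open>i\<^sup>2 * i ^ i\<^sup>2\<close> by a factor of order
  \<open>i ^ (2 * i + 1) * exp i\<close>. The number \<open>i ^ (3 * i)\<close> of copies outgrows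
  this.\<close>

lemma next_copy_length_ratio_tendsto_zero:
  "(\<lambda>i::nat. real ((Suc i)\<^sup>2 * Suc i ^ ((Suc i)\<^sup>2)) / real (i ^ (3 * i) * (i\<^sup>2 * i ^ i\<^sup>2))) \<longlonglongrightarrow> 0"
proof -
  have "(\<lambda>i::nat. (real i + 1)\<^sup>2 * (real i + 1) powr ((real i + 1)\<^sup>2)
      / (real i powr (3 * real i) * ((real i)\<^sup>2 * real i powr (real i)\<^sup>2))) \<longlonglongrightarrow> 0"
    by real_asymp
  moreover have "\<forall>\<^sub>F i::nat in sequentially. (real i + 1)\<^sup>2 * (real i + 1) powr ((real i + 1)\<^sup>2)
      / (real i powr (3 * real i) * ((real i)\<^sup>2 * real i powr (real i)\<^sup>2))
     = real ((Suc i)\<^sup>2 * Suc i ^ ((Suc i)\<^sup>2)) / real (i ^ (3 * i) * (i\<^sup>2 * i ^ i\<^sup>2))"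
    \<comment> \<open>The conversion from \<open>powr\<close> to powers uses a positive
      base.\<close>
    using eventually_gt_at_top[of 0]
  proof eventually_elim
    case (elim i)
    have "(real i + 1) powr ((real i + 1)\<^sup>2) = real (Suc i) powr real ((Suc i)\<^sup>2)"
      by (simp add: add.commute)
    then have 1: "(real i + 1) powr ((real i + 1)\<^sup>2) = real (Suc i) ^ ((Suc i)\<^sup>2)"
      by (subst (asm) powr_realpow) auto
    have 2: "real i powr (3 * real i) = real i ^ (3 * i)"
      using powr_realpow[of "real i" "3 * i"] elim by simp
    have 3: "real i powr (real i)\<^sup>2 = real i ^ i\<^sup>2"
      using powr_realpow[of "real i" "i\<^sup>2"] elim by simp
    show ?case unfolding 1 2 3 by (simp add: add.commute)
  qed
  ultimately show ?thesis by (rule Lim_transform_eventually)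
qed

section \<open>Distribution normality of \<open>x\<close>\<close>

theorem theorem6:
  fixes X :: "nat \<Rightarrow> block" and b l :: "nat \<Rightarrow> nat"
  assumes "X 1 = [0, 1]" and "b 1 = 2" and "l 1 = 0"
    and "\<And>i. i \<ge> 2 \<Longrightarrow> X i = C_block i (i ^ 2)"
    and "\<And>i. i \<ge> 2 \<Longrightarrow> b i = i"
    and "\<And>i. i \<ge> 2 \<Longrightarrow> l i = i ^ (3 * i)"
  shows "distribution_normal (assoc_Q l b X) (assoc_x l b X)"
proof -
  let ?L = "partial_len l X" and ?E = "assoc_E l X" and ?Q = "assoc_Q l b X"
  let ?T = "\<lambda>n. T_map ?Q n (assoc_x l b X)"
  have K: "length (X i) = i\<^sup>2 * i ^ i\<^sup>2" if "i \<ge> 2" for i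
    using assms(4)[OF that] by (simp add: length_C_block)
  \<comment> \<open>As \<open>l 1 = 0\<close>, the first stage contains no copy.\<close>
  have i_ge_2: "i \<ge> 2" if "1 \<le> i" "m < l i" for i m
    using that assms(3) by (cases "i = 1") auto
  \<comment> \<open>The last stage alone is a lower bound for \<open>L i\<close> that is large
    enough for both the divergence and the ratio.\<close>
  have L_ge: "l i * length (X i) \<le> ?L i" if "i \<ge> 2" for i
    using that by (cases i) (simp_all add: partial_len_def)
  have copy_ge: "i \<le> l i * length (X i)" if "i \<ge> 2" for i
  proof -
    have "i ^ 1 \<le> i ^ (3 * i)" using that by (intro power_increasing) auto
    also have "\<dots> \<le> i ^ (3 * i) * (i\<^sup>2 * i ^ i\<^sup>2)" using that by simp
    finally show ?thesis using assms(6)[OF that] K[OF that] by simp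
  qed
  have L: "filterlim ?L at_top sequentially"
    using filterlim_ident
  proof (rule filterlim_at_top_mono)
    show "\<forall>\<^sub>F i in sequentially. i \<le> ?L i"
      using eventually_ge_at_top[of 2]
      by eventually_elim (meson L_ge copy_ge order_trans)
  qed
  have ratio: "(\<lambda>i. length (X (Suc i)) / ?L i) \<longlonglongrightarrow> 0"
  proof (rule tendsto_sandwich[OF _ _ tendsto_const next_copy_length_ratio_tendsto_zero])
    show "\<forall>\<^sub>F i in sequentially. length (X (Suc i)) / ?L i
        \<le> real ((Suc i)\<^sup>2 * Suc i ^ ((Suc i)\<^sup>2)) / real (i ^ (3 * i) * (i\<^sup>2 * i ^ i\<^sup>2))"
      using eventually_ge_at_top[of 2]
    proof eventually_elim
      case (elim i)
      have eq: "i ^ (3 * i) * (i\<^sup>2 * i ^ i\<^sup>2) = l i * length (X i)"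
        using K[OF elim] assms(6)[OF elim] by simp
      have "l i * length (X i) > 0" using copy_ge[OF elim] elim by linarith
      then show ?case unfolding eq using K[of "Suc i"] elim L_ge[OF elim]
        by (intro frac_le) (simp_all only: of_nat_le_iff of_nat_0_less_iff of_nat_0_le_iff)
    qed
  qed simp
  \<comment> \<open>Every index lies in a copy, where the base is \<open>i\<close> and the digit is
    an entry of \<open>C_block i (i\<^sup>2)\<close>. This admissibility is what
    \<open>T_map_bounds\<close> requires.\<close>
  have E_less: "?E n < ?Q n" if "n \<ge> 1" for n
  proof -
    obtain j where "?L j \<ge> n"
      using L unfolding filterlim_at_top eventually_sequentially by blast
    then have "n - 1 < ?L j" using that by simp
    then obtain i m r where imr: "1 \<le> i" "m < l i" "r < length (X i)"
        "n - 1 = ?L (i - 1) + m * length (X i) + r"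
      by (rule copy_exists)
    then have "n = Suc (?L (i - 1) + m * length (X i) + r)" using that by simp
    then have "?E n = X i ! r" "?Q n = i"
      using assoc_in_copy(1)[of i m l r X] assoc_in_copy(2)[of i m l r X b] imr assms(5)[OF i_ge_2] by auto
    moreover have "X i ! r < i"
      using nth_mem[OF imr(3)] set_lex_blocks[of i "i\<^sup>2"] assms(4)[OF i_ge_2, OF imr(1,2)]
      by (auto simp: C_block_def)
    ultimately show ?thesis by simp
  qed
  note T_bounds = T_map_bounds[of ?E ?Q, OF E_less, folded assoc_x_def]
  \<comment> \<open>Intervals \<open>[0, t)\<close> suffice, since
    \<open>[\<alpha>, \<beta>)\<close> is a difference of two of them; \<open>t = 0\<close> is
    included for the case \<open>\<alpha> = 0\<close>.\<close>
  have initial: "(\<lambda>N. (\<Sum>n<N. of_bool (?T n < t) - t) / N) \<longlonglongrightarrow> 0" if t: "0 \<le> t" "t \<le> 1" for t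
  proof (rule averages_tendsto_zero_if_blockwise[OF _ _ _ ratio L])
    show "\<bar>of_bool (?T n < t) - t\<bar> \<le> 1" for n using t by auto
    show "(\<lambda>i. 3 / real i) \<longlonglongrightarrow> 0" by real_asymp
    fix i m assume im: "1 \<le> i" "m < l i"
    then have "i \<ge> 2" by (rule i_ge_2)
    let ?n = "\<lambda>r. ?L (i - 1) + m * length (X i) + r"
    have "real (X i ! r) / i \<le> ?T (?n r) \<and> ?T (?n r) \<le> Suc (X i ! r) / i"
      if "r < length (X i)" "Suc (X i ! r) < i" for r
      using T_bounds[of "?n r"] assoc_in_copy(1)[of i m l r X] assoc_in_copy(2)[of i m l r X b] im that assms(5)[OF \<open>i \<ge> 2\<close>] by simp
    then show "\<bar>\<Sum>r<length (X i). of_bool (?T (?n r) < t) - t\<bar> \<le> 3 / i * length (X i)"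
      using t \<open>i \<ge> 2\<close> unfolding assms(4)[OF \<open>i \<ge> 2\<close>]
      by (intro C_block_discrepancy) auto
  qed
  show ?thesis
    unfolding distribution_normal_def uniformly_distributed_mod1_def
  proof (intro allI impI, elim conjE)
    fix \<alpha> \<beta> :: real assume ab: "0 \<le> \<alpha>" "\<alpha> < \<beta>" "\<beta> \<le> 1"
    have "(\<lambda>N. (\<Sum>n<N. of_bool (?T n < \<beta>) - \<beta>) / N - (\<Sum>n<N. of_bool (?T n < \<alpha>) - \<alpha>) / N + (\<beta> - \<alpha>))
        \<longlonglongrightarrow> 0 - 0 + (\<beta> - \<alpha>)"
      using ab by (intro tendsto_intros initial) auto
    moreover have "\<forall>\<^sub>F N in sequentially.
        (\<Sum>n<N. of_bool (?T n < \<beta>) - \<beta>) / N - (\<Sum>n<N. of_bool (?T n < \<alpha>) - \<alpha>) / N + (\<beta> - \<alpha>)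
        = card {n. n < N \<and> frac (?T n) \<in> {\<alpha>..<\<beta>}} / N"
      \<comment> \<open>For positive \<open>N\<close> the constants summed over \<open>n < N\<close>
        and divided by \<open>N\<close> cancel against \<open>\<beta> - \<alpha>\<close>.\<close>
      using eventually_gt_at_top[of 0]
    proof eventually_elim
      case (elim N)
      have "{n. n < N \<and> frac (?T n) \<in> {\<alpha>..<\<beta>}} = {..<N} \<inter> {n. \<alpha> \<le> ?T n \<and> ?T n < \<beta>}"
        by (auto simp: T_map_def)
      then have "card {n. n < N \<and> frac (?T n) \<in> {\<alpha>..<\<beta>}}
          = (\<Sum>n<N. of_bool (\<alpha> \<le> ?T n \<and> ?T n < \<beta>) :: real)"
        by simp
      also have "\<dots> = (\<Sum>n<N. of_bool (?T n < \<beta>) - of_bool (?T n < \<alpha>))"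
        using ab by (intro sum.cong) auto
      finally show ?case
        using elim by (simp only: sum_subtractf) (simp add: field_simps)
    qed
    ultimately show "(\<lambda>N. real (card {n. n < N \<and> frac (?T n) \<in> {\<alpha>..<\<beta>}}) / real N)
        \<longlonglongrightarrow> \<beta> - \<alpha>"
      by (simp only: diff_self add_0_left) (rule Lim_transform_eventually)
  qed
qed

end
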